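(* There is a total computable random-preserving surjection $f:\{0,1\}^\omega\to\{0,1\}^\omega$ which has no continuous inversion.
   Context: Reals are elements of $\{0,1\}^\omega$ with the Cantor space topology, and $\mu$ is the uniform measure. A partial function $f:\subseteq\{0,1\}^\omega\to\{0,1\}^\omega$ is partial computable if there is an oracle Turing functional $\Phi$ such that for every $x$: $x\in\mathrm{dom}(f)$ iff $\Phi^x(n)\downarrow$ for all $n$; and if $x\in\mathrm{dom}(f)$ then $\Phi^x(n)=f(x)(n)$ for all $n$. It is total computable if in addition $\mathrm{dom}(f)=\{0,1\}^\omega$. Random means Martin-Löf random. $f$ is random-preserving if $\mu(\mathrm{dom}(f))>0$ and $f(x)$ is random for each random $x\in\mathrm{dom}(f)$. A partial function $g:\subseteq\{0,1\}^\omega\to\{0,1\}^\omega$ is an inversion of $f$ if for every $y$ in the range of $f$, $g(y)$ is defined, lies in $\mathrm{dom}(f)$, and $f(g(y))=y$. A partial function is continuous if it is continuous on its domain. *)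

theory Defs
  imports "HOL-Probability.Probability" "HOL-Library.Nat_Bijection"
begin

text \<open>
  Reals are elements of \<open>nat \<Rightarrow> bool\<close>.  The library gives \<open>bool\<close> the discrete topology and
  function types the product topology, so this is Cantor space.
\<close>
type_synonym cantor = "nat \<Rightarrow> bool"

definition cantor_measure :: "cantor measure" where
  "cantor_measure = PiM UNIV (\<lambda>_::nat. uniform_count_measure (UNIV :: bool set))"

definition cylinder :: "bool list \<Rightarrow> cantor set" where
  "cylinder \<sigma> = {x. \<forall>i<length \<sigma>. x i = \<sigma> ! i}"


text \<open>
  Turing functionals are given by Kleene's partial recursive schemes extended by a basic function
  that returns a bit of the real supplied as external information.
\<close>
datatype functional =
    Zero
  | Successor
  | Proj nat
  | Query
  | Comp functional "functional list"
  | Prec functional functional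
  | Mu functional

text \<open>
  \<open>evaluates x \<Phi> as v\<close> says that the computation of \<open>\<Phi>\<close> relative to \<open>x\<close> on the arguments \<open>as\<close>
  converges with value \<open>v\<close>.  If the number of arguments does not fit, there is no value.
\<close>
inductive evaluates :: "cantor \<Rightarrow> functional \<Rightarrow> nat list \<Rightarrow> nat \<Rightarrow> bool" for x :: cantor where
  Zero: "evaluates x Zero as 0"
| Successor: "evaluates x Successor [a] (Suc a)"
| Proj: "i < length as \<Longrightarrow> evaluates x (Proj i) as (as ! i)"
| Query: "evaluates x Query [a] (of_bool (x a))"
| Comp: "list_all2 (\<lambda>\<Psi> b. evaluates x \<Psi> as b) \<Psi>s bs \<Longrightarrow> evaluates x \<Phi> bs v
    \<Longrightarrow> evaluates x (Comp \<Phi> \<Psi>s) as v"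
| Prec_0: "evaluates x \<Phi> as v \<Longrightarrow> evaluates x (Prec \<Phi> \<Psi>) (0 # as) v"
| Prec_Suc: "evaluates x (Prec \<Phi> \<Psi>) (n # as) r \<Longrightarrow> evaluates x \<Psi> (r # n # as) v
    \<Longrightarrow> evaluates x (Prec \<Phi> \<Psi>) (Suc n # as) v"
| Mu: "evaluates x \<Phi> (n # as) 0 \<Longrightarrow> (\<forall>m<n. \<exists>r. evaluates x \<Phi> (m # as) (Suc r))
    \<Longrightarrow> evaluates x (Mu \<Phi>) as n"

definition partial_computable :: "(cantor \<rightharpoonup> cantor) \<Rightarrow> bool" where
  "partial_computable f \<longleftrightarrow> (\<exists>\<Phi>. \<forall>x.
     (x \<in> dom f \<longleftrightarrow> (\<forall>n. \<exists>v. evaluates x \<Phi> [n] v)) \<and>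
     (x \<in> dom f \<longrightarrow> (\<forall>n. evaluates x \<Phi> [n] (of_bool (the (f x) n)))))"

definition total_computable :: "(cantor \<rightharpoonup> cantor) \<Rightarrow> bool" where
  "total_computable f \<longleftrightarrow> partial_computable f \<and> dom f = UNIV"


text \<open>
  Relative to the constantly zero real, \<open>Query\<close> is a constant function, so what follows is
  ordinary unrelativized enumerability: \<open>W\<close> is the domain of a partial recursive function.
\<close>
definition computably_enumerable :: "nat set \<Rightarrow> bool" where
  "computably_enumerable W \<longleftrightarrow> (\<exists>\<Phi>. W = {n. \<exists>v. evaluates (\<lambda>_. False) \<Phi> [n] v})"

definition string_code :: "bool list \<Rightarrow> nat" where
  "string_code \<sigma> = list_encode (map of_bool \<sigma>)"

definition uniformly_ce_open :: "(nat \<Rightarrow> cantor set) \<Rightarrow> bool" where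
  "uniformly_ce_open U \<longleftrightarrow> (\<exists>W. computably_enumerable W \<and>
     (\<forall>n. U n = \<Union> (cylinder ` {\<sigma>. prod_encode (n, string_code \<sigma>) \<in> W})))"

definition ml_test :: "(nat \<Rightarrow> cantor set) \<Rightarrow> bool" where
  "ml_test U \<longleftrightarrow> uniformly_ce_open U \<and> (\<forall>n. measure cantor_measure (U n) \<le> (1/2) ^ n)"

definition ml_random :: "cantor \<Rightarrow> bool" where
  "ml_random x \<longleftrightarrow> (\<forall>U. ml_test U \<longrightarrow> x \<notin> (\<Inter>n. U n))"


text \<open>
  The domain of a partial computable function is a \<open>G\<^sub>\<delta>\<close> set, hence measurable, so for these
  functions the value of \<open>measure\<close> below is never the default value for a non-measurable set.
\<close>
definition random_preserving :: "(cantor \<rightharpoonup> cantor) \<Rightarrow> bool" where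
  "random_preserving f \<longleftrightarrow> measure cantor_measure (dom f) > 0 \<and>
     (\<forall>x\<in>dom f. ml_random x \<longrightarrow> ml_random (the (f x)))"

definition inversion :: "(cantor \<rightharpoonup> cantor) \<Rightarrow> (cantor \<rightharpoonup> cantor) \<Rightarrow> bool" where
  "inversion f g \<longleftrightarrow> (\<forall>y\<in>ran f. \<exists>x\<in>dom f. g y = Some x \<and> f x = Some y)"

definition continuous_partial :: "(cantor \<rightharpoonup> cantor) \<Rightarrow> bool" where
  "continuous_partial g \<longleftrightarrow> continuous_on (dom g) (\<lambda>y. the (g y))"

end

theory Submission
  imports Defs
begin

text \<open>
  The map \<open>overwrite\<close> reads a real \<open>b z\<close> with first bit \<open>b\<close>, drops \<open>b\<close>, and puts it back in
  place of the bit of \<open>z\<close> that follows the first \<open>1\<close> of \<open>z\<close>: it sends \<open>b 0\<^sup>k 1 d w\<close> to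
  \<open>0\<^sup>k 1 b w\<close>, and both reals \<open>b 0 0 0 \<dots>\<close> to \<open>0 0 0 \<dots>\<close>. Every real is a value, since the bit
  to be written can be prescribed as \<open>b\<close>.

  There is no continuous inversion because \<open>0\<^sup>k 1 0 0 0 \<dots>\<close> and \<open>0\<^sup>k 1 1 0 0 \<dots>\<close> both converge
  to \<open>0 0 0 \<dots>\<close>, while a preimage of \<open>0\<^sup>k 1 d \<dots>\<close> must begin with \<open>d\<close>
  (\<open>overwrite_eq_one_thenD\<close>). The first bit of a continuous inversion at \<open>0 0 0 \<dots>\<close> would
  have to be both \<open>0\<close> and \<open>1\<close>.

  For randomness it suffices to pull tests back along the map, so preimages must not gain
  measure and must stay uniformly enumerable. As to measure, among the reals whose image has
  its first \<open>1\<close> at a given place the map just selects coordinates along a fixed injection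
  \<open>source p\<close>; such a selection leaves the uniform measure invariant, and the pieces add up
  because the images are disjoint (\<open>emeasure_vimage_overwrite_le\<close>). As to enumerability, bit
  \<open>n\<close> of the value depends on the bits up to \<open>n + 1\<close> only. So the map acts on strings,
  shortening them by one, and the preimage of a cylinder is the union of the cylinders of
  the strings sent to its string (\<open>vimage_overwrite_cylinder\<close>). This reduces the enumeration
  of a preimage to composing the given partial recursive function with a total recursive
  function on codes.

  What remains is programming. Its two instances, with bits supplied by the oracle and with
  bits decoded from the code of a string, are both handled by \<open>rel_computable_overwrite\<close>, in
  which the source of the bits is a parameter.
\<close>

section \<open>Total functions computable relative to a real\<close>

inductive_cases evaluates_ZeroE: "evaluates x Zero as v"
inductive_cases evaluates_SuccessorE: "evaluates x Successor as v"
inductive_cases evaluates_ProjE: "evaluates x (Proj i) as v"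
inductive_cases evaluates_QueryE: "evaluates x Query as v"
inductive_cases evaluates_CompE: "evaluates x (Comp \<Phi> \<Psi>s) as v"
inductive_cases evaluates_Prec_0E: "evaluates x (Prec \<Phi> \<Psi>) (0 # as) v"
inductive_cases evaluates_Prec_SucE: "evaluates x (Prec \<Phi> \<Psi>) (Suc n # as) v"
inductive_cases evaluates_MuE: "evaluates x (Mu \<Phi>) as v"

text \<open>
  Determinism turns a converging run of a composed functional into a converging run at the
  actual value of the inner one; this is what makes preimages of enumerable sets enumerable.
\<close>
lemma evaluates_deterministic:
  "evaluates x \<Phi> as v \<Longrightarrow> evaluates x \<Phi> as w \<Longrightarrow> v = w"
proof (induction arbitrary: w rule: evaluates.induct)
  case (Comp as \<Psi>s bs \<Phi> v)
  from Comp.prems obtain cs where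
    cs: "list_all2 (\<lambda>\<Psi> b. evaluates x \<Psi> as b) \<Psi>s cs" "evaluates x \<Phi> cs w"
    by (elim evaluates_CompE) (rule that)
  have "bs = cs"
  proof (rule nth_equalityI)
    show "length bs = length cs"
      using list_all2_lengthD[OF Comp.IH(1)] list_all2_lengthD[OF cs(1)] by simp
    show "bs ! i = cs ! i" if "i < length bs" for i
      using list_all2_nthD2[OF Comp.IH(1) that] list_all2_nthD2[OF cs(1)] that \<open>length bs = length cs\<close>
      by auto
  qed
  then show ?case
    using Comp.IH(2) cs(2) by blast
next
  case (Prec_Suc \<Phi> \<Psi> n as r v)
  from Prec_Suc.prems obtain s where
    "evaluates x (Prec \<Phi> \<Psi>) (n # as) s" "evaluates x \<Psi> (s # n # as) w"
    by (elim evaluates_Prec_SucE) (rule that)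
  with Prec_Suc.IH show ?case
    by blast
next
  case (Mu \<Phi> n as)
  from Mu.prems have w: "evaluates x \<Phi> (w # as) 0"
    "\<forall>m<w. \<exists>r. evaluates x \<Phi> (m # as) (Suc r)"
    by (auto elim: evaluates_MuE)
  show ?case
  proof (rule linorder_cases[of n w])
    assume "n < w"
    with w(2) obtain r where "evaluates x \<Phi> (n # as) (Suc r)" by blast
    with Mu.IH(1) show ?thesis by blast
  next
    assume "w < n"
    with Mu.IH(2) obtain r where "\<And>u. evaluates x \<Phi> (w # as) u \<Longrightarrow> Suc r = u" by blast
    with w(1) show ?thesis by blast
  qed
next
  case (Zero as)
  then show ?case by (elim evaluates_ZeroE) simp
next
  case (Successor a)
  then show ?case by (elim evaluates_SuccessorE) simp
next
  case (Proj i as)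
  from Proj.prems show ?case by (elim evaluates_ProjE) simp
next
  case (Query a)
  then show ?case by (elim evaluates_QueryE) simp
next
  case (Prec_0 \<Phi> as v \<Psi>)
  from Prec_0.prems show ?case by (elim evaluates_Prec_0E) (rule Prec_0.IH)
qed

text \<open>
  Totality is built in: only the search operator needs a side condition for it, and the
  other closure properties then hold unconditionally. The value on argument lists of a
  different length is left open.
\<close>
definition rel_computable :: "nat \<Rightarrow> (cantor \<Rightarrow> nat list \<Rightarrow> nat) \<Rightarrow> bool" where
  "rel_computable k g \<longleftrightarrow> (\<exists>\<Phi>. \<forall>x as. length as = k \<longrightarrow> evaluates x \<Phi> as (g x as))"

lemma rel_computable_cong:
  "rel_computable k g \<Longrightarrow> (\<And>x as. length as = k \<Longrightarrow> g x as = h x as) \<Longrightarrow> rel_computable k h"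
  unfolding rel_computable_def by metis

lemma rel_computable_proj: "i < k \<Longrightarrow> rel_computable k (\<lambda>x as. as ! i)"
  unfolding rel_computable_def by (intro exI[of _ "Proj i"]) (auto intro: evaluates.Proj)

lemma rel_computable_comp:
  assumes "rel_computable (length gs) h" and "\<And>g. g \<in> set gs \<Longrightarrow> rel_computable k g"
  shows "rel_computable k (\<lambda>x as. h x (map (\<lambda>g. g x as) gs))"
proof -
  obtain \<Phi> where \<Phi>: "\<And>x as. length as = length gs \<Longrightarrow> evaluates x \<Phi> as (h x as)"
    using assms(1) unfolding rel_computable_def by blast
  have "\<forall>g\<in>set gs. \<exists>\<Psi>. \<forall>x as. length as = k \<longrightarrow> evaluates x \<Psi> as (g x as)"
    using assms(2) unfolding rel_computable_def by blast
  then obtain P where P: "\<And>g x as. g \<in> set gs \<Longrightarrow> length as = k \<Longrightarrow> evaluates x (P g) as (g x as)"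
    by metis
  have "evaluates x (Comp \<Phi> (map P gs)) as (h x (map (\<lambda>g. g x as) gs))" if "length as = k" for x as
    by (rule evaluates.Comp[OF _ \<Phi>]) (auto simp: list_all2_conv_all_nth intro!: P that)
  then show ?thesis
    unfolding rel_computable_def by blast
qed

lemma rel_computable_unary:
  assumes "rel_computable 1 (\<lambda>x as. h x (as ! 0))" and "rel_computable k a"
  shows "rel_computable k (\<lambda>x as. h x (a x as))"
  using rel_computable_comp[of "[a]", OF _ , of "\<lambda>x as. h x (as ! 0)" k] assms by simp

lemma rel_computable_binary:
  assumes "rel_computable 2 (\<lambda>x as. h x (as ! 0) (as ! 1))"
    and "rel_computable k a" and "rel_computable k b"
  shows "rel_computable k (\<lambda>x as. h x (a x as) (b x as))"
  using rel_computable_comp[of "[a, b]", OF _ , of "\<lambda>x as. h x (as ! 0) (as ! 1)" k] assms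
  by (auto simp: numeral_2_eq_2)

lemma rel_computable_Suc:
  assumes "rel_computable k a"
  shows "rel_computable k (\<lambda>x as. Suc (a x as))"
proof (rule rel_computable_unary[OF _ assms])
  have "evaluates x Successor as (Suc (as ! 0))" if "length as = 1" for x as
    using that evaluates.Successor[of x "as ! 0"] by (cases as) auto
  then show "rel_computable 1 (\<lambda>x as. Suc (as ! 0))"
    unfolding rel_computable_def by blast
qed

lemma rel_computable_query:
  assumes "rel_computable k a"
  shows "rel_computable k (\<lambda>x as. of_bool (x (a x as)))"
proof (rule rel_computable_unary[OF _ assms])
  have "evaluates x Query as (of_bool (x (as ! 0)))" if "length as = 1" for x as
    using that evaluates.Query[of x "as ! 0"] by (cases as) auto
  then show "rel_computable 1 (\<lambda>x as. of_bool (x (as ! 0)))"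
    unfolding rel_computable_def by blast
qed

lemma rel_computable_const: "rel_computable k (\<lambda>x as. c)"
proof (induction c)
  case 0
  show ?case
    unfolding rel_computable_def by (intro exI[of _ Zero]) (auto intro: evaluates.Zero)
qed (rule rel_computable_Suc)

text \<open>
  Prepending a computed argument while keeping the others is how the functionals \<open>Prec\<close> and
  \<open>Mu\<close>, whose distinguished argument comes first, are applied inside a larger expression.
\<close>
lemma rel_computable_extend:
  assumes h: "rel_computable (Suc k) h" and a: "rel_computable k a"
  shows "rel_computable k (\<lambda>x as. h x (a x as # as))"
proof (rule rel_computable_cong)
  let ?gs = "a # map (\<lambda>i x as. as ! i) [0..<k]"
  show "rel_computable k (\<lambda>x as. h x (map (\<lambda>g. g x as) ?gs))"
    using h a by (intro rel_computable_comp) (auto intro: rel_computable_proj)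
  show "h x (map (\<lambda>g. g x as) ?gs) = h x (a x as # as)" if "length as = k" for x as
    using map_nth[of as] that by (simp add: comp_def)
qed

text \<open>
  The step function sees the list \<open>r # i # as\<close>, so in its body the previous value is
  \<open>bs ! 0\<close>, the counter is \<open>bs ! 1\<close>, and the original arguments start at index \<open>2\<close>.
\<close>
lemma rel_computable_rec:
  assumes h: "rel_computable (Suc (Suc k)) h"
    and a: "rel_computable k a" and n: "rel_computable k n"
  shows "rel_computable k (\<lambda>x as. rec_nat (a x as) (\<lambda>i r. h x (r # i # as)) (n x as))"
proof -
  obtain \<Phi> where \<Phi>: "\<And>x as. length as = k \<Longrightarrow> evaluates x \<Phi> as (a x as)"
    using a unfolding rel_computable_def by blast
  obtain \<Psi> where \<Psi>: "\<And>x as. length as = Suc (Suc k) \<Longrightarrow> evaluates x \<Psi> as (h x as)"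
    using h unfolding rel_computable_def by blast
  have *: "evaluates x (Prec \<Phi> \<Psi>) (m # as) (rec_nat (a x as) (\<lambda>i r. h x (r # i # as)) m)"
    if "length as = k" for x as m
    by (induction m) (auto intro!: evaluates.Prec_0 \<Phi> that evaluates.Prec_Suc \<Psi>)
  have "rel_computable (Suc k) (\<lambda>x as. rec_nat (a x (tl as)) (\<lambda>i r. h x (r # i # tl as)) (hd as))"
    unfolding rel_computable_def
    by (intro exI[of _ "Prec \<Phi> \<Psi>"]) (auto simp: length_Suc_conv intro: *)
  from rel_computable_extend[OF this n] show ?thesis
    by simp
qed

lemma rel_computable_Least:
  assumes h: "rel_computable (Suc k) h" and ex: "\<And>x as. length as = k \<Longrightarrow> \<exists>n. h x (n # as) = 0"
  shows "rel_computable k (\<lambda>x as. LEAST n. h x (n # as) = 0)"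
proof -
  obtain \<Phi> where \<Phi>: "\<And>x as. length as = Suc k \<Longrightarrow> evaluates x \<Phi> as (h x as)"
    using h unfolding rel_computable_def by blast
  have "evaluates x (Mu \<Phi>) as (LEAST n. h x (n # as) = 0)" (is "evaluates x _ as ?n")
    if l: "length as = k" for x as
  proof (rule evaluates.Mu)
    have "h x (?n # as) = 0"
      using LeastI_ex[OF ex[OF l]] .
    then show "evaluates x \<Phi> (?n # as) 0"
      using \<Phi>[of "?n # as" x] l by simp
    show "\<forall>m<?n. \<exists>r. evaluates x \<Phi> (m # as) (Suc r)"
    proof (intro allI impI)
      fix m assume "m < ?n"
      then have "h x (m # as) \<noteq> 0"
        using not_less_Least by blast
      then show "\<exists>r. evaluates x \<Phi> (m # as) (Suc r)"
        using \<Phi>[of "m # as" x] l by (metis length_Cons not0_implies_Suc)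
    qed
  qed
  then show ?thesis
    unfolding rel_computable_def by blast
qed

lemma rel_computable_add:
  assumes "rel_computable k a" and "rel_computable k b"
  shows "rel_computable k (\<lambda>x as. a x as + b x as)"
proof (rule rel_computable_cong)
  show "rel_computable k (\<lambda>x as. rec_nat (a x as) (\<lambda>i r. (\<lambda>x bs. Suc (bs ! 0)) x (r # i # as)) (b x as))"
    by (intro rel_computable_rec rel_computable_Suc rel_computable_proj assms) simp
  have "rec_nat m (\<lambda>i r. Suc r) n = m + n" for m n :: nat
    by (induction n) auto
  then show "rec_nat (a x as) (\<lambda>i r. (\<lambda>x bs. Suc (bs ! 0)) x (r # i # as)) (b x as) = a x as + b x as" for x as
    by simp
qed

lemma rel_computable_diff:
  assumes "rel_computable k a" and "rel_computable k b"
  shows "rel_computable k (\<lambda>x as. a x as - b x as)"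
proof (rule rel_computable_cong)
  have pred: "rel_computable j (\<lambda>x as. c x as - 1)" if "rel_computable j c" for j c
  proof (rule rel_computable_cong)
    show "rel_computable j (\<lambda>x as. rec_nat 0 (\<lambda>i r. (\<lambda>x bs. bs ! 1) x (r # i # as)) (c x as))"
      by (intro rel_computable_rec rel_computable_const rel_computable_proj that) simp
    show "rec_nat 0 (\<lambda>i r. (\<lambda>x bs. bs ! 1) x (r # i # as)) (c x as) = c x as - 1" for x as
      by (cases "c x as") auto
  qed
  show "rel_computable k (\<lambda>x as. rec_nat (a x as) (\<lambda>i r. (\<lambda>x bs. bs ! 0 - 1) x (r # i # as)) (b x as))"
    by (intro rel_computable_rec pred rel_computable_proj assms) simp
  have "rec_nat m (\<lambda>i r. r - 1) n = m - n" for m n :: nat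
    by (induction n) auto
  then show "rec_nat (a x as) (\<lambda>i r. (\<lambda>x bs. bs ! 0 - 1) x (r # i # as)) (b x as) = a x as - b x as" for x as
    by simp
qed

text \<open>
  Primitive recursion on the condition, with a step that ignores the previous value,
  branches on whether the condition vanishes.
\<close>
lemma rel_computable_if:
  assumes "rel_computable k c" and "rel_computable k a" and "rel_computable k b"
  shows "rel_computable k (\<lambda>x as. if c x as = 0 then a x as else b x as)"
proof (rule rel_computable_cong)
  let ?h = "\<lambda>x bs. b x (drop 2 bs)"
  have h: "rel_computable (Suc (Suc k)) ?h"
  proof (rule rel_computable_cong)
    let ?gs = "map (\<lambda>i x as. as ! (i + 2)) [0..<k] :: (cantor \<Rightarrow> nat list \<Rightarrow> nat) list"
    show "rel_computable (Suc (Suc k)) (\<lambda>x bs. b x (map (\<lambda>g. g x bs) ?gs))"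
      by (intro rel_computable_comp) (auto simp: assms intro: rel_computable_proj[of "Suc (Suc _)", simplified])
    show "b x (map (\<lambda>g. g x bs) ?gs) = b x (drop 2 bs)" if "length bs = Suc (Suc k)" for x bs
      using that by (intro arg_cong[of _ _ "b x"] nth_equalityI) (auto simp: add.commute)
  qed
  show "rel_computable k (\<lambda>x as. rec_nat (a x as) (\<lambda>i r. ?h x (r # i # as)) (c x as))"
    by (intro rel_computable_rec h assms)
  show "rec_nat (a x as) (\<lambda>i r. ?h x (r # i # as)) (c x as) = (if c x as = 0 then a x as else b x as)" for x as
    by (cases "c x as") auto
qed

section \<open>Codes of pairs and lists\<close>

lemma rel_computable_triangle:
  assumes "rel_computable k a"
  shows "rel_computable k (\<lambda>x as. triangle (a x as))"
proof (rule rel_computable_cong)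
  show "rel_computable k (\<lambda>x as. rec_nat 0 (\<lambda>i r. (\<lambda>x bs. bs ! 0 + Suc (bs ! 1)) x (r # i # as)) (a x as))"
    by (intro rel_computable_rec rel_computable_add rel_computable_Suc rel_computable_const
        rel_computable_proj assms) simp_all
  have "rec_nat 0 (\<lambda>i r. r + Suc i) n = triangle n" for n
    by (induction n) auto
  then show "rec_nat 0 (\<lambda>i r. (\<lambda>x bs. bs ! 0 + Suc (bs ! 1)) x (r # i # as)) (a x as) = triangle (a x as)" for x as
    by simp
qed

lemma rel_computable_prod_encode:
  assumes "rel_computable k a" and "rel_computable k b"
  shows "rel_computable k (\<lambda>x as. prod_encode (a x as, b x as))"
  unfolding prod_encode_def prod.case
  by (intro rel_computable_add rel_computable_triangle assms)

text \<open>
  The code of \<open>(m, n)\<close> is \<open>triangle (m + n) + m\<close>, which lies in the half-open interval from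
  \<open>triangle (m + n)\<close> to \<open>triangle (m + n + 1)\<close>. Hence a search for the next larger
  triangular number recovers \<open>m + n\<close>, and with it the pair.
\<close>
lemma triangle_root_prod_encode: "(LEAST s. Suc (prod_encode (m, n)) - triangle (Suc s) = 0) = m + n"
proof (rule Least_equality)
  show "Suc (prod_encode (m, n)) - triangle (Suc (m + n)) = 0"
    by (simp add: prod_encode_def)
next
  fix s assume s: "Suc (prod_encode (m, n)) - triangle (Suc s) = 0"
  have mono: "triangle i \<le> triangle j" if "i \<le> j" for i j
    using that by (induction rule: dec_induct) auto
  show "m + n \<le> s"
  proof (rule ccontr)
    assume "\<not> m + n \<le> s"
    then have "triangle (Suc s) \<le> triangle (m + n)" by (intro mono) simp
    with s show False by (simp add: prod_encode_def)
  qed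
qed

lemma rel_computable_prod_decode:
  assumes "rel_computable k a"
  shows "rel_computable k (\<lambda>x as. fst (prod_decode (a x as)))"
    and "rel_computable k (\<lambda>x as. snd (prod_decode (a x as)))"
proof -
  let ?root = "\<lambda>c. LEAST s. Suc c - triangle (Suc s) = 0"
  have root: "?root c = fst (prod_decode c) + snd (prod_decode c)" for c
    using triangle_root_prod_encode[of "fst (prod_decode c)" "snd (prod_decode c)"] by simp
  have decode: "fst (prod_decode c) = c - triangle (?root c)"
      "snd (prod_decode c) = ?root c - (c - triangle (?root c))" for c
    using prod_decode_inverse[of c] unfolding root by (auto simp: prod_encode_def split: prod.splits)
  have ex: "\<exists>n. Suc c - triangle (Suc n) = 0" for c
    by (intro exI[of _ c]) simp
  have "rel_computable 1 (\<lambda>x as. LEAST n. (\<lambda>x bs. Suc (bs ! 1) - triangle (Suc (bs ! 0))) x (n # as) = 0)"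
    by (intro rel_computable_Least rel_computable_diff rel_computable_triangle rel_computable_Suc
        rel_computable_proj) (use ex in auto)
  then have r: "rel_computable 1 (\<lambda>x as. ?root (as ! 0))"
    by simp
  have r': "rel_computable k (\<lambda>x as. ?root (a x as))"
    by (rule rel_computable_unary[OF r assms])
  show "rel_computable k (\<lambda>x as. fst (prod_decode (a x as)))"
    unfolding decode by (intro rel_computable_diff rel_computable_triangle r' assms)
  show "rel_computable k (\<lambda>x as. snd (prod_decode (a x as)))"
    unfolding decode by (intro rel_computable_diff rel_computable_triangle r' assms)
qed

text \<open>
  Removing the head of a coded list is a total operation on codes, because \<open>0\<close> codes both
  the empty list and the pair \<open>(0, 0)\<close>. Iterating it gives access to all entries and to the
  length.
\<close>
lemma rel_computable_drop:
  assumes "rel_computable k a" and "rel_computable k b"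
  shows "rel_computable k (\<lambda>x as. list_encode (drop (a x as) (list_decode (b x as))))"
proof (rule rel_computable_cong)
  have tail: "snd (prod_decode (c - 1)) = list_encode (tl (list_decode c))" for c
  proof (cases c)
    case 0
    then show ?thesis
      using prod_encode_inverse[of "(0, 0)"] by (simp add: prod_encode_def)
  next
    case (Suc n)
    then show ?thesis
      by (simp split: prod.splits)
  qed
  show "rel_computable k (\<lambda>x as. rec_nat (b x as)
      (\<lambda>i r. (\<lambda>x bs. snd (prod_decode (bs ! 0 - 1))) x (r # i # as)) (a x as))"
    by (intro rel_computable_rec rel_computable_prod_decode rel_computable_diff rel_computable_const
        rel_computable_proj assms) simp
  have "rec_nat c (\<lambda>i r. snd (prod_decode (r - 1))) n = list_encode (drop n (list_decode c))" for c n
    by (induction n) (simp_all only: nat.rec drop0 list_decode_inverse tail list_encode_inverse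
        drop_Suc tl_drop)
  then show "rec_nat (b x as) (\<lambda>i r. (\<lambda>x bs. snd (prod_decode (bs ! 0 - 1))) x (r # i # as)) (a x as)
      = list_encode (drop (a x as) (list_decode (b x as)))" for x as
    by simp
qed


lemma list_encode_eq_0_iff: "list_encode xs = 0 \<longleftrightarrow> xs = []"
  by (cases xs) auto

text \<open>
  Bits beyond the end of the coded string are \<open>False\<close>, so that every code determines a real.
\<close>
definition code_bit :: "nat \<Rightarrow> cantor" where
  "code_bit c i \<longleftrightarrow> i < length (list_decode c) \<and> list_decode c ! i \<noteq> 0"

lemma rel_computable_code_bit: "rel_computable 2 (\<lambda>x as. of_bool (code_bit (as ! 1) (as ! 0)))"
proof (rule rel_computable_cong)
  let ?hd = "\<lambda>i c. fst (prod_decode (list_encode (drop i (list_decode c)) - 1))"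
  show "rel_computable 2 (\<lambda>x as. 1 - (1 - ?hd (as ! 0) (as ! 1)))"
    by (intro rel_computable_diff rel_computable_const rel_computable_prod_decode rel_computable_drop
        rel_computable_proj) simp_all
  have "?hd i c = (if i < length (list_decode c) then list_decode c ! i else 0)" for i c
  proof (cases "i < length (list_decode c)")
    case True
    then show ?thesis
      by (simp add: Cons_nth_drop_Suc[symmetric])
  next
    case False
    then show ?thesis
      using prod_encode_inverse[of "(0, 0)"] by (simp add: prod_encode_def)
  qed
  then show "1 - (1 - ?hd (as ! 0) (as ! 1)) = of_bool (code_bit (as ! 1) (as ! 0))" for as
    by (simp add: code_bit_def)
qed

lemma rel_computable_length: "rel_computable 1 (\<lambda>x as. length (list_decode (as ! 0)))"
proof (rule rel_computable_cong)
  show "rel_computable 1 (\<lambda>x as. LEAST n.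
      (\<lambda>x bs. list_encode (drop (bs ! 0) (list_decode (bs ! 1)))) x (n # as) = 0)"
    by (intro rel_computable_Least rel_computable_drop rel_computable_proj)
      (auto simp: list_encode_eq_0_iff)
  show "(LEAST n. (\<lambda>x bs. list_encode (drop (bs ! 0) (list_decode (bs ! 1)))) x (n # as) = 0)
      = length (list_decode (as ! 0))" for x :: cantor and as
    by (rule Least_equality) (auto simp: list_encode_eq_0_iff)
qed

text \<open>
  Since list codes grow at the front, the recursion produces the entries from the last to
  the first.
\<close>
lemma rel_computable_list_encode:
  assumes g: "rel_computable 2 (\<lambda>x as. g x (as ! 0) (as ! 1))"
    and l: "rel_computable 1 (\<lambda>x as. l x (as ! 0))"
    and a: "rel_computable k a"
  shows "rel_computable k (\<lambda>x as. list_encode (map (\<lambda>i. g x i (a x as)) [0..<l x (a x as)]))"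
proof (rule rel_computable_unary[OF _ a], rule rel_computable_cong)
  show "rel_computable 1 (\<lambda>x as. rec_nat 0 (\<lambda>i r. (\<lambda>x bs.
      Suc (prod_encode (g x (l x (bs ! 2) - Suc (bs ! 1)) (bs ! 2), bs ! 0))) x (r # i # as)) (l x (as ! 0)))"
    by (intro rel_computable_rec rel_computable_Suc rel_computable_prod_encode rel_computable_binary[OF g]
        rel_computable_diff rel_computable_unary[OF l] rel_computable_const rel_computable_proj) simp_all
  have "i \<le> m \<Longrightarrow> rec_nat 0 (\<lambda>i r. Suc (prod_encode (f (m - Suc i), r))) i
      = list_encode (map f [m - i..<m])" for f m i
  proof (induction i)
    case (Suc i)
    then have "[m - Suc i..<m] = (m - Suc i) # [m - i..<m]"
      by (simp add: upt_conv_Cons Suc_diff_Suc)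
    with Suc show ?case
      by simp
  qed simp
  from this[of "l x (as ! 0)" "l x (as ! 0)" "\<lambda>i. g x i (as ! 0)" for x as]
  show "rec_nat 0 (\<lambda>i r. (\<lambda>x bs.
      Suc (prod_encode (g x (l x (bs ! 2) - Suc (bs ! 1)) (bs ! 2), bs ! 0))) x (r # i # as)) (l x (as ! 0))
    = list_encode (map (\<lambda>i. g x i (as ! 0)) [0..<l x (as ! 0)])" for x as
    by (simp add: numeral_2_eq_2)
qed

section \<open>Preimages of enumerable sets\<close>

lemma computably_enumerable_vimage:
  assumes W: "computably_enumerable W" and h: "rel_computable 1 (\<lambda>x as. h (as ! 0))"
  shows "computably_enumerable (h -` W)"
proof -
  obtain \<Phi> where \<Phi>: "W = {n. \<exists>v. evaluates (\<lambda>_. False) \<Phi> [n] v}"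
    using W unfolding computably_enumerable_def by blast
  obtain H where H: "\<And>x as. length as = 1 \<Longrightarrow> evaluates x H as (h (as ! 0))"
    using h unfolding rel_computable_def by blast
  have "h n \<in> W \<longleftrightarrow> (\<exists>v. evaluates (\<lambda>_. False) (Comp \<Phi> [H]) [n] v)" for n
  proof
    assume "h n \<in> W"
    then obtain v where "evaluates (\<lambda>_. False) \<Phi> [h n] v"
      using \<Phi> by blast
    then have "evaluates (\<lambda>_. False) (Comp \<Phi> [H]) [n] v"
      using H[of "[n]"] by (intro evaluates.Comp) auto
    then show "\<exists>v. evaluates (\<lambda>_. False) (Comp \<Phi> [H]) [n] v" ..
  next
    assume "\<exists>v. evaluates (\<lambda>_. False) (Comp \<Phi> [H]) [n] v"
    then obtain v bs where "list_all2 (\<lambda>\<Psi> b. evaluates (\<lambda>_. False) \<Psi> [n] b) [H] bs"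
      and v: "evaluates (\<lambda>_. False) \<Phi> bs v"
      by (elim exE evaluates_CompE) blast
    then obtain b where b: "bs = [b]" "evaluates (\<lambda>_. False) H [n] b"
      by (auto simp: list_all2_Cons1)
    then have "b = h n"
      using evaluates_deterministic[OF b(2) H[of "[n]"]] by simp
    with b v show "h n \<in> W"
      using \<Phi> by blast
  qed
  then show ?thesis
    unfolding computably_enumerable_def by (intro exI[of _ "Comp \<Phi> [H]"]) auto
qed

section \<open>The map and its computability\<close>

definition overwrite :: "cantor \<Rightarrow> cantor" where
  "overwrite x n = (if 0 < n \<and> x n \<and> (\<forall>j. 0 < j \<and> j < n \<longrightarrow> \<not> x j) then x 0 else x (Suc n))"

text \<open>
  The index of the bit is argument \<open>0\<close>; argument \<open>1\<close> is a parameter that \<open>\<beta>\<close> may use to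
  determine the real to which the map is applied. Whether the first \<open>1\<close> after the initial
  bit is at \<open>n\<close> is tested by counting: bit \<open>n\<close> is set and exactly one of the bits from \<open>1\<close>
  to \<open>n\<close> is set.
\<close>
lemma rel_computable_overwrite:
  assumes "rel_computable 2 (\<lambda>x as. of_bool (\<beta> x (as ! 1) (as ! 0)))"
  shows "rel_computable 2 (\<lambda>x as. of_bool (overwrite (\<beta> x (as ! 1)) (as ! 0)))"
proof (rule rel_computable_cong)
  let ?bit = "\<lambda>x c i. of_bool (\<beta> x c i) :: nat"
  let ?count = "\<lambda>x c n. rec_nat 0 (\<lambda>i r. r + ?bit x c (Suc i)) n"
  note bit = rel_computable_binary[where h = "\<lambda>x i c. ?bit x c i", OF assms]
  have "rel_computable 2 (\<lambda>x as. rec_nat 0 (\<lambda>i r.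
      (\<lambda>x bs. bs ! 0 + ?bit x (bs ! 3) (Suc (bs ! 1))) x (r # i # as)) (as ! 0))"
    by (intro rel_computable_rec rel_computable_add bit rel_computable_Suc rel_computable_const
        rel_computable_proj) simp_all
  then have count: "rel_computable 2 (\<lambda>x as. ?count x (as ! 1) (as ! 0))"
    by (simp add: numeral_3_eq_3)
  \<comment> \<open>The test value vanishes iff bit \<open>n\<close> is set and the count up to \<open>n\<close> is \<open>1\<close>;
    as counting starts after bit \<open>0\<close>, this forces \<open>0 < n\<close>.\<close>
  let ?test = "\<lambda>x n c. (1 - ?bit x c n) + ((?count x c n - 1) + (1 - ?count x c n))"
  show "rel_computable 2 (\<lambda>x as. if ?test x (as ! 0) (as ! 1) = 0
      then ?bit x (as ! 1) 0 else ?bit x (as ! 1) (Suc (as ! 0)))"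
    by (intro rel_computable_if rel_computable_add rel_computable_diff bit rel_computable_Suc
        rel_computable_const rel_computable_proj count) simp_all
  have count_0: "?count x c n = 0 \<longleftrightarrow> (\<forall>j. 0 < j \<and> j < Suc n \<longrightarrow> \<not> \<beta> x c j)" for x c n
    by (induction n) (auto simp: less_Suc_eq)
  have "?test x n c = 0 \<longleftrightarrow> 0 < n \<and> \<beta> x c n \<and> (\<forall>j. 0 < j \<and> j < n \<longrightarrow> \<not> \<beta> x c j)" for x n c
  proof (cases n)
    case (Suc m)
    then show ?thesis
      using count_0[of x c m] by auto
  qed simp
  then show "(if ?test x (as ! 0) (as ! 1) = 0 then ?bit x (as ! 1) 0 else ?bit x (as ! 1) (Suc (as ! 0)))
      = of_bool (overwrite (\<beta> x (as ! 1)) (as ! 0))" for x as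
    by (simp only: overwrite_def if_distrib[of of_bool])
qed

lemma total_computable_overwrite: "total_computable (Some \<circ> overwrite)"
proof -
  have "rel_computable 2 (\<lambda>x as. of_bool (overwrite x (as ! 0)))"
    by (intro rel_computable_overwrite[where \<beta> = "\<lambda>x _. x"] rel_computable_query rel_computable_proj) simp
  then have "rel_computable 1 (\<lambda>x as. of_bool (overwrite x (as ! 0)))"
    by (rule rel_computable_binary[where h = "\<lambda>x n _. of_bool (overwrite x n)"])
      (auto intro: rel_computable_proj)
  then obtain \<Phi> where "\<And>x n. evaluates x \<Phi> [n] (of_bool (overwrite x n))"
    unfolding rel_computable_def by (metis One_nat_def length_Cons list.size(3) nth_Cons_0)
  moreover have "dom (Some \<circ> overwrite) = UNIV"
    by auto
  ultimately show ?thesis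
    unfolding total_computable_def partial_computable_def by (metis UNIV_I comp_apply option.sel)
qed

section \<open>Preimages of effectively open sets\<close>

text \<open>
  The last bit of the value would need one bit more than the string provides, hence the
  string is shortened by one; padding it with \<open>False\<close> is harmless, since the padding is
  never consulted.
\<close>
definition overwrite_string :: "bool list \<Rightarrow> bool list" where
  "overwrite_string \<tau> = map (overwrite (\<lambda>i. i < length \<tau> \<and> \<tau> ! i)) [0..<length \<tau> - 1]"

lemma overwrite_cong:
  assumes "\<And>i. i \<le> Suc n \<Longrightarrow> x i = y i"
  shows "overwrite x n = overwrite y n"
  using assms by (auto simp: overwrite_def)

lemma overwrite_string_cylinder:
  assumes "x \<in> cylinder \<tau>"
  shows "overwrite x \<in> cylinder (overwrite_string \<tau>)"
  using assms by (auto simp: cylinder_def overwrite_string_def intro!: overwrite_cong)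

text \<open>
  A real in the preimage of the cylinder of \<open>\<sigma>\<close> has a prefix of length \<open>length \<sigma> + 1\<close>, and
  that prefix is sent to \<open>\<sigma>\<close> exactly. The exact length matters: the set of strings that
  enumerates an open set need not be closed under extension.
\<close>
lemma vimage_overwrite_cylinder:
  "overwrite -` cylinder \<sigma> = \<Union> (cylinder ` {\<tau>. overwrite_string \<tau> = \<sigma>})"
proof (intro equalityI subsetI)
  fix x assume x: "x \<in> overwrite -` cylinder \<sigma>"
  let ?\<tau> = "map x [0..<Suc (length \<sigma>)]"
  have \<tau>: "x \<in> cylinder ?\<tau>"
    by (auto simp: cylinder_def simp del: upt_Suc)
  have "overwrite_string ?\<tau> = \<sigma>"
  proof (rule nth_equalityI)
    show "length (overwrite_string ?\<tau>) = length \<sigma>"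
      by (simp add: overwrite_string_def)
    then show "overwrite_string ?\<tau> ! i = \<sigma> ! i" if "i < length (overwrite_string ?\<tau>)" for i
      using x overwrite_string_cylinder[OF \<tau>] that by (auto simp: cylinder_def)
  qed
  with \<tau> show "x \<in> \<Union> (cylinder ` {\<tau>. overwrite_string \<tau> = \<sigma>})"
    by blast
qed (use overwrite_string_cylinder in blast)

text \<open>
  The enumerating set for the preimages is itself a preimage, under the action of
  \<open>overwrite_string\<close> on codes.
\<close>
lemma uniformly_ce_open_vimage_overwrite:
  assumes "uniformly_ce_open U"
  shows "uniformly_ce_open (\<lambda>n. overwrite -` U n)"
proof -
  obtain W where W: "computably_enumerable W"
    and U: "\<And>n. U n = \<Union> (cylinder ` {\<sigma>. prod_encode (n, string_code \<sigma>) \<in> W})"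
    using assms unfolding uniformly_ce_open_def by blast
  define H where "H c = list_encode (map (\<lambda>i. of_bool (overwrite (code_bit c) i))
    [0..<length (list_decode c) - 1])" for c
  define h where "h c = prod_encode (fst (prod_decode c), H (snd (prod_decode c)))" for c
  have H: "H (string_code \<tau>) = string_code (overwrite_string \<tau>)" for \<tau>
  proof -
    have "code_bit (string_code \<tau>) = (\<lambda>i. i < length \<tau> \<and> \<tau> ! i)"
      by (auto simp: code_bit_def string_code_def fun_eq_iff)
    then show ?thesis
      by (simp add: H_def string_code_def overwrite_string_def comp_def)
  qed
  have "rel_computable 1 (\<lambda>x as. h (as ! 0))"
    unfolding h_def H_def
    by (intro rel_computable_prod_encode rel_computable_prod_decode rel_computable_proj
        rel_computable_list_encode rel_computable_overwrite rel_computable_code_bit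
        rel_computable_diff rel_computable_length rel_computable_const) simp_all
  then have "computably_enumerable (h -` W)"
    by (rule computably_enumerable_vimage[OF W])
  moreover have "overwrite -` U n = \<Union> (cylinder ` {\<tau>. prod_encode (n, string_code \<tau>) \<in> h -` W})" for n
  proof -
    have "overwrite -` U n = (\<Union>\<sigma>\<in>{\<sigma>. prod_encode (n, string_code \<sigma>) \<in> W}. overwrite -` cylinder \<sigma>)"
      by (auto simp: U)
    also have "\<dots> = \<Union> (cylinder ` {\<tau>. prod_encode (n, string_code (overwrite_string \<tau>)) \<in> W})"
      by (auto simp: vimage_overwrite_cylinder)
    finally show ?thesis
      by (simp add: h_def H)
  qed
  ultimately show ?thesis
    unfolding uniformly_ce_open_def by blast
qed

section \<open>Preimages do not gain measure\<close>

lemma prob_space_bit: "prob_space (uniform_count_measure (UNIV :: bool set))"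
  by (rule prob_space_uniform_count_measure) auto

lemma prob_space_cantor_measure: "prob_space cantor_measure"
  unfolding cantor_measure_def by (intro prob_space_PiM prob_space_bit)

lemma space_cantor_measure [simp]: "space cantor_measure = UNIV"
  by (simp add: cantor_measure_def space_PiM space_uniform_count_measure)

lemma sets_cylinder: "cylinder \<sigma> \<in> sets cantor_measure"
proof -
  have "{x. x i = b} \<in> sets cantor_measure" for i b
  proof -
    have "(\<lambda>x. x i) -` {b} \<inter> space cantor_measure \<in> sets cantor_measure"
      unfolding cantor_measure_def
      by (rule measurable_sets[OF measurable_component_singleton]) auto
    then show ?thesis
      by (simp add: vimage_def)
  qed
  then have "(\<Inter>i\<in>{..<length \<sigma>}. {x. x i = \<sigma> ! i}) \<in> sets cantor_measure" if "\<sigma> \<noteq> []"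
    using that by (intro sets.finite_INT) auto
  moreover have "cylinder \<sigma> = (\<Inter>i\<in>{..<length \<sigma>}. {x. x i = \<sigma> ! i})"
    by (auto simp: cylinder_def)
  ultimately show ?thesis
    using sets.top[of cantor_measure] by (cases "\<sigma> = []") auto
qed

lemma distr_cantor_measure_reindex:
  assumes "inj \<rho>"
  shows "distr cantor_measure cantor_measure (\<lambda>x. x \<circ> \<rho>) = cantor_measure"
  using distr_PiM_reindex[of UNIV "\<lambda>_. uniform_count_measure (UNIV :: bool set)" \<rho> UNIV] assms
  by (simp add: cantor_measure_def prob_space_bit comp_def restrict_def)

text \<open>
  Positions are counted from \<open>1\<close> here: a member of \<open>first_one p\<close> has its first \<open>1\<close> at index
  \<open>p - 1\<close>, which is index \<open>p\<close> in a real that has one more bit in front. The value \<open>p = 0\<close>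
  stands for the real without any \<open>1\<close>, so the sets partition Cantor space.
\<close>
definition first_one :: "nat \<Rightarrow> cantor set" where
  "first_one p = (if p = 0 then {\<lambda>_. False} else {y. \<forall>i<p. y i \<longleftrightarrow> Suc i = p})"

lemma sets_first_one: "first_one p \<in> sets cantor_measure"
proof (cases "p = 0")
  case True
  have "first_one 0 = (\<Inter>n. cylinder (replicate n False))"
    by (auto simp: first_one_def cylinder_def)
  then show ?thesis
    using True by (auto intro!: sets.countable_INT sets_cylinder)
next
  case False
  then have "first_one p = cylinder (map (\<lambda>i. Suc i = p) [0..<p])"
    by (auto simp: first_one_def cylinder_def)
  then show ?thesis
    by (simp add: sets_cylinder)
qed

lemma disjoint_family_first_one: "disjoint_family first_one"
proof -
  have "y \<notin> first_one q" if y: "y \<in> first_one p" and "p < q" for p q y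
  proof
    assume q: "y \<in> first_one q"
    show False
    proof (cases "p = 0")
      case True
      with y have "\<not> y (q - 1)"
        by (simp add: first_one_def)
      with q \<open>p < q\<close> show False
        by (simp add: first_one_def)
    next
      case False
      with y have "y (p - 1)"
        by (simp add: first_one_def)
      with q \<open>p < q\<close> False show False
        by (auto simp: first_one_def)
    qed
  qed
  then show ?thesis
    unfolding disjoint_family_on_def by (metis disjoint_iff linorder_neqE_nat)
qed

definition source :: "nat \<Rightarrow> nat \<Rightarrow> nat" where
  "source p n = (if 0 < p \<and> n = p then 0 else Suc n)"

lemma inj_source: "inj (source p)"
  by (auto simp: inj_def source_def split: if_splits)

text \<open>
  The map decides where to read by looking at the real, but on each piece of a countable
  partition this decision is constant, and the piece can be recognized from the value alone.
\<close>
lemma overwrite_eq_source: "\<exists>p. overwrite x = x \<circ> source p \<and> overwrite x \<in> first_one p"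
proof (cases "\<exists>p>0. x p")
  case True
  define p where "p = (LEAST p. 0 < p \<and> x p)"
  have p: "0 < p" "x p"
    using LeastI_ex[OF True] by (auto simp: p_def)
  have less: "\<not> x j" if "0 < j" "j < p" for j
    using not_less_Least[of j "\<lambda>p. 0 < p \<and> x p"] that by (auto simp: p_def)
  have "0 < n \<and> x n \<and> (\<forall>j. 0 < j \<and> j < n \<longrightarrow> \<not> x j) \<longleftrightarrow> n = p" for n
    using p less by (metis linorder_neqE_nat)
  then have eq: "overwrite x = x \<circ> source p"
    using p by (auto simp: fun_eq_iff overwrite_def source_def)
  moreover have "overwrite x \<in> first_one p"
    unfolding eq first_one_def source_def using p less by (auto, metis Suc_lessI zero_less_Suc)
  ultimately show ?thesis
    by blast
next
  case False
  then have zero: "\<not> x n" if "0 < n" for n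
    using that by blast
  then have "overwrite x n = x (Suc n)" for n
    by (auto simp: overwrite_def)
  with zero have "overwrite x = x \<circ> source 0 \<and> overwrite x \<in> first_one 0"
    by (simp add: fun_eq_iff source_def first_one_def)
  then show ?thesis ..
qed

text \<open>
  The preimage of \<open>A\<close> is covered by the preimages of the disjoint sets \<open>A \<inter> first_one p\<close>
  under the measure-preserving maps \<open>x \<mapsto> x \<circ> source p\<close>.
\<close>
lemma emeasure_vimage_overwrite_le:
  assumes A: "A \<in> sets cantor_measure"
  shows "emeasure cantor_measure (overwrite -` A) \<le> emeasure cantor_measure A"
proof -
  let ?M = cantor_measure
  let ?P = "\<lambda>p. (\<lambda>x. x \<circ> source p) -` (A \<inter> first_one p)"
  have meas: "(\<lambda>x. x \<circ> source p) \<in> measurable ?M ?M" for p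
    unfolding cantor_measure_def comp_def
    by (rule measurable_PiM_single') (auto simp: space_PiM intro!: measurable_component_singleton)
  have A': "A \<inter> first_one p \<in> sets ?M" for p
    using A sets_first_one by auto
  have P: "?P p \<in> sets ?M" "emeasure ?M (?P p) = emeasure ?M (A \<inter> first_one p)" for p
    using measurable_sets[OF meas A', of p p] emeasure_distr[OF meas A', of p p]
    by (auto simp: distr_cantor_measure_reindex[OF inj_source])
  have "emeasure ?M (overwrite -` A) \<le> emeasure ?M (\<Union>p. ?P p)"
  proof (rule emeasure_mono)
    show "overwrite -` A \<subseteq> (\<Union>p. ?P p)"
    proof
      fix x assume "x \<in> overwrite -` A"
      moreover obtain p where "overwrite x = x \<circ> source p" "overwrite x \<in> first_one p"
        using overwrite_eq_source by blast
      ultimately have "x \<in> ?P p"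
        by simp
      then show "x \<in> (\<Union>p. ?P p)"
        by blast
    qed
  qed (use P in auto)
  also have "\<dots> \<le> (\<Sum>p. emeasure ?M (?P p))"
    using P by (intro emeasure_subadditive_countably) auto
  also have "\<dots> = (\<Sum>p. emeasure ?M (A \<inter> first_one p))"
    by (simp only: P(2))
  also have "\<dots> = emeasure ?M (\<Union>p. A \<inter> first_one p)"
    using A' disjoint_family_first_one
    by (intro suminf_emeasure) (auto simp: disjoint_family_on_def)
  also have "\<dots> \<le> emeasure ?M A"
    using A by (intro emeasure_mono) auto
  finally show ?thesis .
qed

lemma ml_test_vimage_overwrite:
  assumes "ml_test U"
  shows "ml_test (\<lambda>n. overwrite -` U n)"
proof -
  interpret prob_space cantor_measure
    by (rule prob_space_cantor_measure)
  have U: "uniformly_ce_open U" "\<And>n. measure cantor_measure (U n) \<le> (1/2) ^ n"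
    using assms by (auto simp: ml_test_def)
  have "measure cantor_measure (overwrite -` U n) \<le> (1/2) ^ n" for n
  proof -
    obtain S where "U n = \<Union> (cylinder ` S)"
      using U(1) unfolding uniformly_ce_open_def by blast
    then have "U n \<in> sets cantor_measure"
      by (auto intro!: sets.countable_UN' sets_cylinder countableI_type)
    then have "measure cantor_measure (overwrite -` U n) \<le> measure cantor_measure (U n)"
      using emeasure_vimage_overwrite_le by (simp add: emeasure_eq_measure)
    also note U(2)
    finally show ?thesis .
  qed
  then show ?thesis
    using U(1) by (simp add: ml_test_def uniformly_ce_open_vimage_overwrite)
qed

lemma random_preserving_overwrite: "random_preserving (Some \<circ> overwrite)"
proof -
  interpret prob_space cantor_measure
    by (rule prob_space_cantor_measure)
  have "ml_random (overwrite x)" if "ml_random x" for x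
    unfolding ml_random_def
  proof (intro allI impI notI)
    fix U assume "ml_test U" "overwrite x \<in> (\<Inter>n. U n)"
    moreover from this have "x \<in> (\<Inter>n. overwrite -` U n)"
      by simp
    ultimately show False
      using that ml_test_vimage_overwrite unfolding ml_random_def by blast
  qed
  moreover have "dom (Some \<circ> overwrite) = space cantor_measure"
    by auto
  then have "measure cantor_measure (dom (Some \<circ> overwrite)) = 1"
    by (simp only: prob_space)
  ultimately show ?thesis
    by (simp add: random_preserving_def)
qed

section \<open>Surjectivity and inversions\<close>

lemma overwrite_case_nat:
  "overwrite (case_nat b y) n =
    (if 0 < n \<and> y (n - 1) \<and> (\<forall>j. Suc j < n \<longrightarrow> \<not> y j) then b else y n)"
proof (cases n)
  case (Suc m)
  have "(\<forall>j. 0 < j \<and> j < Suc m \<longrightarrow> \<not> P (j - 1)) \<longleftrightarrow> (\<forall>j. j < m \<longrightarrow> \<not> P j)" for P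
    by (metis Suc_less_eq Suc_pred diff_Suc_1 zero_less_Suc)
  moreover have "case_nat b y j = y (j - 1)" if "0 < j" for j
    using that by (cases j) auto
  ultimately show ?thesis
    using Suc by (auto simp: overwrite_def)
qed (simp add: overwrite_def)

text \<open>
  If \<open>k\<close> is the place of the first \<open>1\<close> of \<open>y\<close>, prepending the bit \<open>y (k + 1)\<close> makes the map
  write back the bit that is already there. For \<open>y\<close> without a \<open>1\<close> nothing is overwritten, so
  the arbitrary value of \<open>LEAST\<close> does no harm.
\<close>
lemma surj_overwrite: "surj overwrite"
proof (rule surjI)
  fix y :: cantor
  define k where "k = (LEAST k. y k)"
  have "overwrite (case_nat (y (Suc k)) y) n = y n" for n
  proof (cases "0 < n \<and> y (n - 1) \<and> (\<forall>j. Suc j < n \<longrightarrow> \<not> y j)")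
    case True
    then have "k = n - 1"
      unfolding k_def by (intro Least_equality) (auto simp: not_less[symmetric])
    with True show ?thesis
      by (simp add: overwrite_case_nat)
  qed (auto simp: overwrite_case_nat)
  then show "overwrite (case_nat (y (Suc (LEAST k. y k))) y) = y"
    unfolding k_def by blast
qed

lemma ran_overwrite: "ran (Some \<circ> overwrite) = UNIV"
  using surj_overwrite by (auto simp: ran_def surj_def) metis

text \<open>
  The real \<open>0\<^sup>k 1 d 0 0 \<dots>\<close>.
\<close>
definition one_then :: "bool \<Rightarrow> nat \<Rightarrow> cantor" where
  "one_then d k i \<longleftrightarrow> i = k \<or> d \<and> i = Suc k"

text \<open>
  The bit after the first \<open>1\<close> of a value is always the first bit of the argument.
\<close>
lemma overwrite_eq_one_thenD:
  assumes "overwrite x = one_then d k"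
  shows "x 0 = d"
proof -
  obtain p where p: "overwrite x = x \<circ> source p" "overwrite x \<in> first_one p"
    using overwrite_eq_source by blast
  have "p \<noteq> 0"
  proof
    assume "p = 0"
    with p(2) have "\<not> overwrite x k"
      by (simp add: first_one_def)
    then show False
      by (simp add: assms one_then_def)
  qed
  with p(2) have first: "\<And>i. i < p \<Longrightarrow> one_then d k i \<longleftrightarrow> Suc i = p"
    by (simp add: first_one_def assms)
  have "one_then d k (p - 1)"
    using first[of "p - 1"] \<open>p \<noteq> 0\<close> by simp
  then have "p = Suc k"
    using first[of k] \<open>p \<noteq> 0\<close> by (auto simp: one_then_def)
  with p(1) have "overwrite x (Suc k) = x 0"
    by (simp add: source_def)
  then show ?thesis
    by (simp add: assms one_then_def)
qed

lemma tendsto_one_then: "one_then d \<longlonglongrightarrow> (\<lambda>_. False)"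
proof -
  have "eventually (\<lambda>k. one_then d k i = False) sequentially" for i
    using eventually_gt_at_top[of i] by eventually_elim (auto simp: one_then_def)
  then have "limitin (product_topology (\<lambda>_. euclidean) UNIV) (one_then d) (\<lambda>_. False) sequentially"
    unfolding limitin_componentwise by (auto intro!: tendsto_eventually)
  then show ?thesis
    by (simp add: euclidean_product_topology)
qed

lemma no_continuous_inversion_overwrite:
  assumes g: "inversion (Some \<circ> overwrite) g"
  shows "\<not> continuous_partial g"
proof
  assume cont: "continuous_partial g"
  define s where "s y = the (g y)" for y
  have "\<forall>y. \<exists>x. g y = Some x \<and> overwrite x = y"
    using g by (auto simp: inversion_def ran_overwrite)
  then have gs: "g y = Some (s y)" and s: "overwrite (s y) = y" for y
    unfolding s_def by (metis option.sel)+
  have "dom g = UNIV"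
    using gs by auto
  then have "continuous_on UNIV (\<lambda>y. s y 0)"
    using cont unfolding continuous_partial_def s_def
    by (auto intro: continuous_on_product_then_coordinatewise)
  then have "(\<lambda>k. s (one_then d k) 0) \<longlonglongrightarrow> s (\<lambda>_. False) 0" for d
    by (rule continuous_on_tendsto_compose[OF _ tendsto_one_then]) auto
  then have "d = s (\<lambda>_. False) 0" for d
    by (simp only: overwrite_eq_one_thenD[OF s] LIMSEQ_const_iff)
  from this[of True] this[of False] show False
    by simp
qed

theorem theorem2p7:
  "\<exists>f :: cantor \<rightharpoonup> cantor.
     total_computable f \<and> random_preserving f \<and> ran f = UNIV \<and>
     \<not> (\<exists>g. inversion f g \<and> continuous_partial g)"
  using total_computable_overwrite random_preserving_overwrite ran_overwrite
    no_continuous_inversion_overwrite by blast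

end
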